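(* Fix an integer $k \ge 2$. There exist constants $c>0$ and $q_0$ (depending only on $k$) such that for all integers $q > k$ with $q \ge q_0$ and all integers $e$ with $(50q)^k < e < 2^q$, there exists an $(e,q,k)$-system $H$ with $\chi(H) \ge c\, e^{1/k} q$. Consequently, for this choice of parameters, $f(e,q,k) = \Theta(e^{1/k} q)$.
   Context: A $k$-uniform hypergraph is called a $k$-graph. For integers $1 \le \ell < k \le q$, an $\ell$-$(q,k)$-system is a $k$-graph whose edge set is the union of the edge sets of a collection of $q$-cliques (a $q$-clique is the complete $k$-graph $\binom{Q}{k}$ on a $q$-element vertex set $Q$), where any two of these $q$-element vertex sets share at most $\ell$ vertices. A $(q,k)$-system means a $(k-1)$-$(q,k)$-system, and an $(e,q,k)$-system is a $(q,k)$-system whose collection of $q$-cliques has exactly $e$ members. The chromatic number $\chi(H)$ of a hypergraph $H$ is the minimum number of colors in a coloring of the vertices in which no edge is monochromatic. $f(e,q,k)$ denotes the maximum chromatic number of a $(q,k)$-system whose number of $q$-cliques is $e$. The $\Theta$ is as $q \to \infty$ with $k$ fixed, i.e. there are constants $0<c_1\le c_2$ depending only on $k$ with $c_1 e^{1/k}q \le f(e,q,k) \le c_2 e^{1/k} q$ in this range. *)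

theory Defs
  imports Complex_Main "HOL-Library.Ramsey"
begin

text \<open>A hypergraph is a pair of a vertex set and an edge set. The edge set of the
  \<open>q\<close>-clique (complete \<open>k\<close>-graph) on a \<open>q\<close>-element set \<open>Q\<close> is \<open>nsets Q k\<close>.\<close>

type_synonym 'a hypergraph = "'a set \<times> 'a set set"

abbreviation verts :: "'a hypergraph \<Rightarrow> 'a set" where
  "verts H \<equiv> fst H"

abbreviation edges :: "'a hypergraph \<Rightarrow> 'a set set" where
  "edges H \<equiv> snd H"

definition k_graph :: "nat \<Rightarrow> 'a hypergraph \<Rightarrow> bool" where
  "k_graph k H \<longleftrightarrow> finite (verts H) \<and> edges H \<subseteq> nsets (verts H) k"

text \<open>The collection of clique vertex sets can be taken to be a set rather than a
  multiset: two equal members would share \<open>q > l\<close> vertices. Isolated vertices are allowed.\<close>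

definition clique_collection :: "nat \<Rightarrow> nat \<Rightarrow> nat \<Rightarrow> 'a set set \<Rightarrow> 'a hypergraph \<Rightarrow> bool" where
  "clique_collection l q k \<Q> H \<longleftrightarrow>
     (\<forall>Q\<in>\<Q>. Q \<subseteq> verts H \<and> card Q = q) \<and>
     (\<forall>Q\<in>\<Q>. \<forall>Q'\<in>\<Q>. Q \<noteq> Q' \<longrightarrow> card (Q \<inter> Q') \<le> l) \<and>
     edges H = (\<Union>Q\<in>\<Q>. nsets Q k)"

definition l_qk_system :: "nat \<Rightarrow> nat \<Rightarrow> nat \<Rightarrow> 'a hypergraph \<Rightarrow> bool" where
  "l_qk_system l q k H \<longleftrightarrow>
     1 \<le> l \<and> l < k \<and> k \<le> q \<and> k_graph k H \<and> (\<exists>\<Q>. clique_collection l q k \<Q> H)"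

definition qk_system :: "nat \<Rightarrow> nat \<Rightarrow> 'a hypergraph \<Rightarrow> bool" where
  "qk_system q k H \<longleftrightarrow> l_qk_system (k - 1) q k H"

definition eqk_system :: "nat \<Rightarrow> nat \<Rightarrow> nat \<Rightarrow> 'a hypergraph \<Rightarrow> bool" where
  "eqk_system e q k H \<longleftrightarrow>
     qk_system q k H \<and> (\<exists>\<Q>. clique_collection (k - 1) q k \<Q> H \<and> finite \<Q> \<and> card \<Q> = e)"

definition monochromatic :: "('a \<Rightarrow> 'c) \<Rightarrow> 'a set \<Rightarrow> bool" where
  "monochromatic c E \<longleftrightarrow> (\<exists>a. \<forall>x\<in>E. c x = a)"

definition colorable :: "'a hypergraph \<Rightarrow> nat \<Rightarrow> bool" where
  "colorable H r \<longleftrightarrow>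
     (\<exists>c :: 'a \<Rightarrow> nat. c ` verts H \<subseteq> {..<r} \<and> (\<forall>E\<in>edges H. \<not> monochromatic c E))"

text \<open>A colouring exists whenever \<open>H\<close> is a (finite) \<open>k\<close>-graph with \<open>k \<ge> 2\<close>, so the minimum
  below is attained in all cases of interest.\<close>

definition chromatic_number :: "'a hypergraph \<Rightarrow> nat" where
  "chromatic_number H = (LEAST r. colorable H r)"

text \<open>Every finite hypergraph is isomorphic to one whose vertices are natural numbers. The
  chromatic number of an \<open>(e,q,k)\<close>-system is at most \<open>max 1 (e * q)\<close>, so the set is finite.\<close>

definition f_max :: "nat \<Rightarrow> nat \<Rightarrow> nat \<Rightarrow> nat" where
  "f_max e q k = Max {chromatic_number H | H :: nat hypergraph. eqk_system e q k H}"

end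

theory Submission
  imports Defs "HOL-Algebra.Algebraic_Closure_Type" "HOL-Library.Z2"
begin

text \<open>Upper bound: an \<open>(e,q,k)\<close>-system has at most \<open>e q^k\<close> edges. With \<open>r \<ge> e^(1/k) q\<close>
  colours, a random colouring has at most \<open>r\<close> monochromatic edges on average; giving one vertex of
  each a private colour yields a proper colouring with \<open>2 r\<close> colours.

  Lower bound: let \<open>F\<close> be a field whose order \<open>2^m\<close> is of the order of magnitude \<open>e^(1/k)\<close>, let
  \<open>A \<subseteq> F\<close> have \<open>q div k\<close> elements, and let \<open>V\<close> be the union of the curves
  \<open>y = x^k + a\<close>, \<open>a \<in> A\<close>, in the plane over \<open>F\<close>. The graph of a polynomial of degree
  below \<open>k\<close> meets each of these curves in at most \<open>k\<close> points, hence \<open>V\<close> in at most \<open>q\<close>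
  points. Take as blocks the traces on \<open>V\<close> of all these graphs and of all vertical lines. By
  interpolation an independent set has points on at most \<open>k - 1\<close> vertical lines, and it has at most
  \<open>k - 1\<close> points on each, so every colour class has at most \<open>(k - 1)^2\<close> of the
  \<open>2^m (q div k)\<close> points.\<close>

section \<open>The upper bound\<close>

text \<open>Union bound over the common colour: once it is fixed, only the \<open>card V - k\<close>
  vertices outside \<open>E\<close> remain free.\<close>

lemma card_monochromatic_colorings:
  assumes "finite V" "E \<in> nsets V k" "k \<ge> 1"
  shows "card {c \<in> V \<rightarrow>\<^sub>E {..<r}. monochromatic c E} \<le> r * r ^ (card V - k)"
proof -
  let ?D = "\<lambda>a x. if x \<in> E then {a} else {..<r}"
  from assms have E: "E \<subseteq> V" "finite E" "card E = k" by (auto simp: nsets_def)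
  then obtain x0 where x0: "x0 \<in> E" using assms(3) by fastforce
  have sub: "{c \<in> V \<rightarrow>\<^sub>E {..<r}. monochromatic c E} \<subseteq> (\<Union>a<r. Pi\<^sub>E V (?D a))"
  proof
    fix c assume c: "c \<in> {c \<in> V \<rightarrow>\<^sub>E {..<r}. monochromatic c E}"
    then obtain a where a: "\<forall>x\<in>E. c x = a" by (auto simp: monochromatic_def)
    \<comment> \<open>\<open>E\<close> has a vertex because \<open>k \<ge> 1\<close>, and this puts
      the common colour among the \<open>r\<close> available ones.\<close>
    have "a < r" using c a x0 E(1) by (auto dest!: PiE_mem[of c _ _ x0])
    moreover have "c \<in> Pi\<^sub>E V (?D a)" using c a by (auto simp: PiE_iff)
    ultimately show "c \<in> (\<Union>a<r. Pi\<^sub>E V (?D a))" by blast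
  qed
  have card_D: "card (Pi\<^sub>E V (?D a)) = r ^ (card V - k)" for a
  proof -
    have "card (Pi\<^sub>E V (?D a)) = (\<Prod>x\<in>V. if x \<in> E then 1 else r)"
      using assms(1) by (auto simp: card_PiE intro!: prod.cong)
    also have "\<dots> = (\<Prod>x\<in>V - E. r)"
      using assms(1) by (intro prod.mono_neutral_cong_right) auto
    finally show ?thesis using E by (simp add: card_Diff_subset)
  qed
  have "card {c \<in> V \<rightarrow>\<^sub>E {..<r}. monochromatic c E} \<le> card (\<Union>a<r. Pi\<^sub>E V (?D a))"
    using assms(1) by (intro card_mono sub finite_UN_I finite_PiE) auto
  also have "\<dots> \<le> (\<Sum>a<r. card (Pi\<^sub>E V (?D a)))" by (rule card_UN_le) simp
  finally show ?thesis by (simp add: card_D)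
qed

text \<open>Averaging over all colourings: an edge is monochromatic in at most a fraction
  \<open>1 / r ^ (k - 1)\<close> of them. The bound is multiplied out to stay within the
  naturals.\<close>

lemma ex_coloring_few_monochromatic:
  assumes "finite V" "\<E> \<subseteq> nsets V k" "k \<ge> 1" "r \<ge> 1"
  obtains c where "c \<in> V \<rightarrow>\<^sub>E {..<r}"
    "card {E \<in> \<E>. monochromatic c E} * r ^ (k - 1) \<le> card \<E>"
proof -
  let ?C = "V \<rightarrow>\<^sub>E {..<r}"
  have fC: "finite ?C" using assms by (intro finite_PiE) auto
  have cC: "card ?C = r ^ card V" using assms by (simp add: card_PiE)
  have fE: "finite \<E>" using assms finite_imp_finite_nsets finite_subset by metis
  have ne: "?C \<noteq> {}" using assms by (auto simp: PiE_eq_empty_iff lessThan_empty_iff)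
  have "\<exists>c\<in>?C. card {E \<in> \<E>. monochromatic c E} * r ^ (k - 1) \<le> card \<E>"
  proof (rule ccontr)
    assume "\<not> ?thesis"
    then have H: "card \<E> < card {E \<in> \<E>. monochromatic c E} * r ^ (k - 1)" if "c \<in> ?C" for c
      using that by auto
    \<comment> \<open>An edge exists, so \<open>k \<le> card V\<close> and the truncated difference
      \<open>card V - k\<close> is exact.\<close>
    from ne H have "\<E> \<noteq> {}" by fastforce
    then obtain E0 where "E0 \<in> \<E>" by blast
    then have kV: "k \<le> card V" using assms(1,2) by (auto simp: nsets_def intro: card_mono)
    have "r ^ card V * card \<E> = (\<Sum>c\<in>?C. card \<E>)" by (simp add: cC)
    also have "\<dots> < (\<Sum>c\<in>?C. card {E \<in> \<E>. monochromatic c E} * r ^ (k - 1))"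
      by (rule sum_strict_mono[OF fC ne H])
    also have "\<dots> = (\<Sum>c\<in>?C. card {E \<in> \<E>. monochromatic c E}) * r ^ (k - 1)"
      by (simp add: sum_distrib_right)
    also have "(\<Sum>c\<in>?C. card {E \<in> \<E>. monochromatic c E})
        = (\<Sum>E\<in>\<E>. card {c \<in> ?C. monochromatic c E})"
      using sum_multicount_gen[OF fC fE, of "\<lambda>c E. monochromatic c E"
          "\<lambda>E. card {c \<in> ?C. monochromatic c E}"] by simp
    also have "\<dots> \<le> (\<Sum>E\<in>\<E>. r * r ^ (card V - k))"
      using assms by (intro sum_mono card_monochromatic_colorings) auto
    also have "\<dots> * r ^ (k - 1) = card \<E> * (r ^ ((card V - k) + Suc (k - 1)))"
      by (simp add: power_add)
    also have "(card V - k) + Suc (k - 1) = card V" using kV assms(3) by simp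
    finally show False by (simp add: mult.commute)
  qed
  then show ?thesis using that by blast
qed

text \<open>Averaging leaves at most \<open>r\<close> monochromatic edges, and one chosen vertex of
  each gets a colour of its own from \<open>r\<close> to \<open>2 * r - 1\<close>. An edge meeting
  the recoloured set \<open>R\<close> is no longer monochromatic as \<open>k \<ge> 2\<close>; an
  edge avoiding \<open>R\<close> keeps its colours and was not monochromatic before.\<close>

lemma colorable_of_few_edges:
  assumes "k_graph k H" "k \<ge> 2" "r \<ge> 1" "card (edges H) \<le> r ^ k"
  shows "colorable H (2 * r)"
proof -
  let ?V = "verts H" and ?E = "edges H"
  have fV: "finite ?V" and sub: "?E \<subseteq> nsets ?V k" using assms(1) by (auto simp: k_graph_def)
  have fE: "finite ?E" using fV sub finite_imp_finite_nsets finite_subset by metis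
  have E: "E \<subseteq> ?V \<and> finite E \<and> card E = k" if "E \<in> ?E" for E
    using sub that by (auto simp: nsets_def)
  obtain c where c: "c \<in> ?V \<rightarrow>\<^sub>E {..<r}"
    and few: "card {E \<in> ?E. monochromatic c E} * r ^ (k - 1) \<le> card ?E"
    using ex_coloring_few_monochromatic[OF fV sub] assms(2,3)
    by (metis One_nat_def Suc_1 Suc_leD)
  define M where "M = {E \<in> ?E. monochromatic c E}"
  have "card M * r ^ (k - 1) \<le> r * r ^ (k - 1)"
    using le_trans[OF few assms(4)] assms(2) by (simp add: M_def flip: power_Suc)
  then have cM: "card M \<le> r" using assms(3) by simp
  have fM: "finite M" using fE by (simp add: M_def)
  have "\<exists>v. v \<in> E" if "E \<in> M" for E
  proof -
    have "card E = k" using E that by (auto simp: M_def)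
    then show ?thesis using assms(2) by (cases "E = {}") auto
  qed
  then obtain v where v: "\<And>E. E \<in> M \<Longrightarrow> v E \<in> E" by metis
  define R where "R = v ` M"
  have fR: "finite R" and cR: "card R \<le> r"
    using fM cM card_image_le[OF fM, of v] by (auto simp: R_def)
  obtain g where g: "inj_on g R" "g ` R \<subseteq> {..<r}"
    using card_le_inj[OF fR, of "{..<r}"] cR by auto
  define c' where "c' = (\<lambda>x. if x \<in> R then r + g x else c x)"
  \<comment> \<open>Old colours lie below \<open>r\<close> and \<open>g\<close> is injective, so a
    recoloured vertex shares its colour with no other vertex.\<close>
  have new: "c' x = c' y \<Longrightarrow> x \<in> R \<Longrightarrow> y \<in> ?V \<Longrightarrow> x = y" for x y
  proof -
    assume a: "c' x = c' y" "x \<in> R" "y \<in> ?V"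
    have "c y < r" using c a(3) by auto
    then have "y \<in> R" using a by (auto simp: c'_def split: if_splits)
    then show "x = y" using a g(1) by (auto simp: c'_def inj_on_def)
  qed
  have "c' ` ?V \<subseteq> {..<2 * r}"
  proof
    fix z assume "z \<in> c' ` ?V"
    then obtain x where x: "x \<in> ?V" "z = c' x" by blast
    have "c x < r" using c x(1) by auto
    moreover have "x \<in> R \<Longrightarrow> g x < r" using g(2) by auto
    ultimately show "z \<in> {..<2 * r}" by (auto simp: x(2) c'_def)
  qed
  moreover have "\<not> monochromatic c' E" if EE: "E \<in> ?E" for E
  proof
    assume mono: "monochromatic c' E"
    show False
    proof (cases "E \<inter> R = {}")
      case True
      obtain a where a: "\<And>x. x \<in> E \<Longrightarrow> c' x = a" using mono by (auto simp: monochromatic_def)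
      have "c x = a" if "x \<in> E" for x using a[OF that] True that by (auto simp: c'_def)
      then have "monochromatic c E" by (auto simp: monochromatic_def)
      then have "E \<in> M" using EE by (simp add: M_def)
      then show False using v True by (auto simp: R_def)
    next
      case False
      then obtain x where x: "x \<in> E" "x \<in> R" by blast
      have "E \<subseteq> {x}"
      proof
        fix y assume "y \<in> E"
        moreover from this have "c' x = c' y" using mono x(1) by (auto simp: monochromatic_def)
        ultimately show "y \<in> {x}" using new[OF _ x(2)] E[OF EE] by blast
      qed
      then have "card E \<le> 1" using card_mono[of "{x}" E] by simp
      then show False using E[OF EE] assms(2) by simp
    qed
  qed
  ultimately show ?thesis unfolding colorable_def by blast
qed

text \<open>\<open>LEAST\<close> is informative only if some number of colours works; this provides
  an actual colouring that attains the minimum.\<close>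

lemma colorable_chromatic_number:
  assumes "k_graph k H" "k \<ge> 2"
  shows "colorable H (chromatic_number H)"
proof -
  have "card (edges H) \<le> (card (edges H) + 1) ^ k"
    using self_le_power[of "card (edges H) + 1" k] assms(2) by simp
  then have "colorable H (2 * (card (edges H) + 1))"
    by (intro colorable_of_few_edges[OF assms]) auto
  then show ?thesis unfolding chromatic_number_def by (rule LeastI)
qed

section \<open>Edge count and chromatic number of systems with \<open>e\<close> cliques\<close>

lemma eqk_system_k_graph: "eqk_system e q k H \<Longrightarrow> k_graph k H"
  by (simp add: eqk_system_def qk_system_def l_qk_system_def)

lemma card_edges_eqk_system:
  assumes "eqk_system e q k H"
  shows "card (edges H) \<le> e * q ^ k"
proof -
  obtain \<Q> where Q: "clique_collection (k - 1) q k \<Q> H" "finite \<Q>" "card \<Q> = e"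
    and kq: "1 \<le> k - 1" "k \<le> q"
    using assms by (auto simp: eqk_system_def qk_system_def l_qk_system_def)
  have "card (edges H) = card (\<Union>Q\<in>\<Q>. nsets Q k)"
    using Q(1) by (simp add: clique_collection_def)
  also have "\<dots> \<le> (\<Sum>Q\<in>\<Q>. card (nsets Q k))" by (rule card_UN_le[OF Q(2)])
  also have "\<dots> \<le> (\<Sum>Q\<in>\<Q>. q ^ k)"
  proof (rule sum_mono)
    fix Q assume "Q \<in> \<Q>"
    then have "card Q = q" using Q(1) by (simp add: clique_collection_def)
    moreover from this have "finite Q" using kq card.infinite by fastforce
    ultimately have "card (nsets Q k) = q choose k" by (simp add: card_nsets)
    also have "\<dots> \<le> q ^ k" using kq by (intro binomial_le_pow) simp
    finally show "card (nsets Q k) \<le> q ^ k" .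
  qed
  finally show ?thesis using Q(3) by simp
qed

text \<open>For \<open>r\<close> the ceiling of \<open>t = e^(1/k) q\<close>, the power
  \<open>r ^ k\<close> is at least \<open>e * q ^ k\<close> and so dominates the number of edges;
  hence \<open>2 * r\<close> colours suffice.\<close>

lemma chromatic_number_eqk_system_le:
  assumes H: "eqk_system e q k H" and "k \<ge> 2" "q \<ge> 1" "e \<ge> 1"
  shows "real (chromatic_number H) \<le> 4 * real e powr (1 / real k) * real q"
proof -
  define t where "t = real e powr (1 / real k) * real q"
  define r where "r = nat \<lceil>t\<rceil>"
  have t1: "t \<ge> 1"
    using mult_mono[of 1 "real e powr (1 / real k)" 1 "real q"] assms
    by (simp add: t_def ge_one_powr_ge_zero)
  have r: "t \<le> real r" "real r \<le> t + 1" "r \<ge> 1" using t1 by (auto simp: r_def) linarith+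
  have "t ^ k = real (e * q ^ k)"
    using assms by (simp add: t_def power_mult_distrib powr_power)
  then have "real (e * q ^ k) \<le> real (r ^ k)"
    using power_mono[OF r(1), of k] t1 by simp
  then have "e * q ^ k \<le> r ^ k" by (simp only: of_nat_le_iff)
  then have "colorable H (2 * r)"
    using card_edges_eqk_system[OF H] r(3) assms(2) eqk_system_k_graph[OF H]
    by (intro colorable_of_few_edges[of k]) auto
  then have "chromatic_number H \<le> 2 * r" unfolding chromatic_number_def by (rule Least_le)
  then have "real (chromatic_number H) \<le> 2 * real r" by linarith
  \<comment> \<open>As \<open>t \<ge> 1\<close>, rounding up costs at most a factor of two:
    \<open>r \<le> t + 1 \<le> 2 * t\<close>.\<close>
  also have "\<dots> \<le> 4 * t" using r t1 by simp
  finally show ?thesis by (simp add: t_def)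
qed

section \<open>Finite fields of prime power order\<close>

lemma finite_frobenius_fixed:
  assumes "n > 1"
  shows "finite {x :: 'a :: field. x ^ n = x}"
proof -
  have "monom 1 n - monom 1 1 \<noteq> (0 :: 'a poly)"
    using assms by (metis coeff_0 coeff_diff coeff_monom diff_zero less_irrefl zero_neq_one)
  then have "finite {x :: 'a. poly (monom 1 n - monom 1 1) x = 0}" by (rule poly_roots_finite)
  then show ?thesis by (simp add: poly_monom)
qed

text \<open>The polynomial \<open>X^n - X\<close> splits into \<open>n\<close> linear factors. Its
  derivative is the constant \<open>- 1\<close>, so no root is repeated and the multiset
  \<open>A\<close> of roots is a set.\<close>

lemma card_frobenius_fixed:
  assumes "n > 1" and "of_nat n = (0 :: 'a)"
  shows "card {x :: 'a :: alg_closed_field. x ^ n = x} = n"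
proof -
  define p :: "'a poly" where "p = monom 1 n - monom 1 1"
  have deg: "degree p = n"
    using degree_add_eq_left[of "- monom 1 1 :: 'a poly" "monom 1 n"] assms(1)
    by (simp add: p_def degree_monom_eq)
  have pd: "pderiv p = - 1"
    using assms(2) by (simp add: p_def pderiv_diff pderiv_monom)
  have "p \<noteq> 0" using deg assms(1) by auto
  then obtain A where A: "size A = n" "p = smult (lead_coeff p) (\<Prod>x\<in>#A. [:-x, 1:])"
    using alg_closed_imp_factorization[of p] deg by blast
  have roots: "set_mset A = {x. x ^ n = x}"
  proof -
    have "poly p x = 0 \<longleftrightarrow> x \<in># A" for x
      using \<open>p \<noteq> 0\<close> by (subst A(2)) (auto simp: poly_prod_mset prod_mset_zero_iff)
    then show ?thesis by (auto simp: p_def poly_monom)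
  qed
  have le1: "count A x \<le> 1" for x
  proof (rule ccontr)
    assume "\<not> count A x \<le> 1"
    then have "{#x, x#} \<subseteq># A" by (auto simp: subseteq_mset_def)
    then obtain B where B: "A = {#x, x#} + B" by (metis subset_mset.le_iff_add)
    have "p = [:-x, 1:] * ([:-x, 1:] * smult (lead_coeff p) (\<Prod>x\<in>#B. [:-x, 1:]))"
      by (subst A(2)) (simp add: B)
    then obtain g where "p = [:-x, 1:] * ([:-x, 1:] * g)" by blast
    then have "poly (pderiv p) x = 0"
      by (simp only: pderiv_mult poly_add poly_mult) simp
    then show False by (simp add: pd)
  qed
  have "A = mset_set (set_mset A)"
  proof (rule multiset_eqI)
    fix x
    show "count A x = count (mset_set (set_mset A)) x"
    proof (cases "x \<in># A")
      case True
      then have "count A x \<ge> 1" by simp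
      then have "count A x = 1" using le1[of x] by linarith
      then show ?thesis using True by simp
    qed (simp add: not_in_iff)
  qed
  then have "size A = card (set_mset A)" by (metis size_mset_set)
  then show ?thesis using A(1) roots by simp
qed

text \<open>Fixes the characteristic of \<open>bit alg_closure\<close>, on which the additivity of
  the Frobenius map rests.\<close>

lemma CHAR_bit: "CHAR(bit) = 2"
proof (rule CHAR_eqI)
  have *: "of_nat n = (of_bool (odd n) :: bit)" for n
    by (induction n) auto
  show "of_nat 2 = (0 :: bit)" by (simp only: *) simp
  show "2 dvd n" if "of_nat n = (0 :: bit)" for n
    using that by (simp add: * of_bool_def split: if_splits)
qed

text \<open>The fixed points of \<open>x \<mapsto> x ^ (2 ^ m)\<close>, a map that is additive in
  characteristic 2. The field is a subset of one ambient field because \<open>m\<close> varies;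
  closure under sums and products is what interpolation by counting uses.\<close>

lemma ex_finite_subfield_power_2:
  assumes "m \<ge> 1"
  obtains F :: "bit alg_closure set" where "finite F" "card F = 2 ^ m" "0 \<in> F" "1 \<in> F"
    "\<And>x y. x \<in> F \<Longrightarrow> y \<in> F \<Longrightarrow> x + y \<in> F" "\<And>x y. x \<in> F \<Longrightarrow> y \<in> F \<Longrightarrow> x * y \<in> F"
proof
  let ?F = "{x :: bit alg_closure. x ^ (2 ^ m) = x}"
  have char: "CHAR(bit alg_closure) = 2" by (simp add: CHAR_bit)
  have gt: "(2::nat) ^ m > 1" using assms by (intro one_less_power) auto
  have "of_nat (2 ^ m) = (0 :: bit alg_closure)"
    unfolding of_nat_eq_0_iff_char_dvd char using assms by simp
  then show "card ?F = 2 ^ m" by (rule card_frobenius_fixed[OF gt])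
  show "finite ?F" by (rule finite_frobenius_fixed[OF gt])
  show "0 \<in> ?F" "1 \<in> ?F" by (auto simp: power_0_left)
  show "x + y \<in> ?F" if "x \<in> ?F" "y \<in> ?F" for x y
    using that freshmans_dream'[where ?'a = "bit alg_closure", of "2 ^ m" m x y] char by simp
  show "x * y \<in> ?F" if "x \<in> ?F" "y \<in> ?F" for x y
    using that by (simp add: power_mult_distrib)
qed

section \<open>The lower bound\<close>

text \<open>Small blocks are filled up with private dummy vertices, and dummy blocks are added to
  reach exactly \<open>e\<close> blocks; neither affects the pairwise intersections of distinct blocks.\<close>

lemma ex_padded_system:
  fixes B :: "'i \<Rightarrow> 'a set"
  assumes fV: "finite V" and fI: "finite I" and cI: "card I \<le> e" and k2: "k \<ge> 2" and kq: "k \<le> q"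
    and sub: "\<And>i. i \<in> I \<Longrightarrow> B i \<subseteq> V" and size: "\<And>i. i \<in> I \<Longrightarrow> card (B i) \<le> q"
    and int: "\<And>i j. i \<in> I \<Longrightarrow> j \<in> I \<Longrightarrow> i \<noteq> j \<Longrightarrow> card (B i \<inter> B j) \<le> k - 1"
    and indep: "\<And>S. S \<subseteq> V \<Longrightarrow> s < card S \<Longrightarrow> \<exists>i\<in>I. k \<le> card (S \<inter> B i)"
  obtains H :: "nat hypergraph" where "eqk_system e q k H" "card V \<le> s * chromatic_number H"
proof -
  obtain h where h: "bij_betw h V {0..<card V}" using ex_bij_betw_finite_nat[OF fV] by blast
  obtain g where g: "bij_betw g {0..<card I} I" using ex_bij_betw_nat_finite[OF fI] by blast
  define n where "n = card V"
  have hinj: "inj_on h V" and him: "h ` V = {0..<n}" using h by (auto simp: bij_betw_def n_def)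
  \<comment> \<open>Indices from \<open>card I\<close> on stand for the dummy blocks, which have no
    point in \<open>V\<close>.\<close>
  define C where "C j = (if j < card I then B (g j) else {})" for j
  have gI: "j < card I \<Longrightarrow> g j \<in> I" for j using g by (auto simp: bij_betw_def)
  have Csub: "C j \<subseteq> V" for j using sub gI by (auto simp: C_def)
  have fC: "finite (C j)" for j using Csub fV finite_subset by blast
  have Csize: "card (C j) \<le> q" for j using size gI by (auto simp: C_def)
  have Cint: "card (C i \<inter> C j) \<le> k - 1" if "i \<noteq> j" for i j
  proof (cases "i < card I \<and> j < card I")
    case True
    moreover from this have "g i \<noteq> g j"
      using g that by (auto simp: bij_betw_def inj_on_def)
    ultimately show ?thesis using int gI by (auto simp: C_def)
  qed (auto simp: C_def)
  \<comment> \<open>Block \<open>j\<close> takes its dummy vertices from a window of length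
    \<open>q\<close> of its own, above all the codes \<open>h v < n\<close>.\<close>
  define D where "D j = {n + j * q..<n + j * q + (q - card (C j))}" for j
  define Q where "Q j = h ` C j \<union> D j" for j
  have hC: "h ` C j \<subseteq> {0..<n}" for j using him Csub by blast
  have hCD: "h ` C i \<inter> D j = {}" for i j using hC[of i] by (force simp: D_def)
  have DD: "D i \<inter> D j = {}" if "i \<noteq> j" for i j
  proof -
    have less: "D i \<inter> D j = {}" if "i < j" for i j
    proof -
      have "Suc i * q \<le> j * q" using that by (intro mult_le_mono1) simp
      then show ?thesis by (auto simp: D_def)
    qed
    show ?thesis using that less[of i j] less[of j i] by (cases "i < j") auto
  qed
  have cardQ: "card (Q j) = q" for j
  proof -
    have "card (h ` C j) = card (C j)"
      by (rule card_image[OF inj_on_subset[OF hinj Csub]])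
    moreover have "finite (D j)" "card (D j) = q - card (C j)" by (simp_all add: D_def)
    ultimately show ?thesis using Csize[of j] fC hCD[of j j]
      by (simp add: Q_def card_Un_disjoint)
  qed
  have Qint: "card (Q i \<inter> Q j) \<le> k - 1" if "i \<noteq> j" for i j
  proof -
    have "Q i \<inter> Q j = h ` C i \<inter> h ` C j"
      using hCD[of i j] hCD[of j i] DD[OF that] by (auto simp: Q_def)
    also have "\<dots> = h ` (C i \<inter> C j)"
      by (rule inj_on_image_Int[OF hinj Csub Csub, symmetric])
    also have "card \<dots> \<le> card (C i \<inter> C j)" using fC by (intro card_image_le) auto
    finally show ?thesis using Cint[OF that] by simp
  qed
  \<comment> \<open>Equal blocks would share \<open>q > k - 1\<close> vertices. Injectivity makes
    the collection have exactly \<open>e\<close> members.\<close>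
  have Qinj: "inj_on Q {..<e}"
  proof (rule inj_onI, rule ccontr)
    fix i j assume "Q i = Q j" "i \<noteq> j"
    then show False using Qint[of i j] cardQ[of i] k2 kq by auto
  qed
  define \<Q> where "\<Q> = Q ` {..<e}"
  define H :: "nat hypergraph" where "H = ({0..<n} \<union> (\<Union>\<Q>), (\<Union>Y\<in>\<Q>. nsets Y k))"
  have fQ: "finite (Q j)" for j using fC by (simp add: Q_def D_def)
  have coll: "clique_collection (k - 1) q k \<Q> H"
    unfolding clique_collection_def
  proof (intro conjI ballI impI)
    fix Y Y' assume "Y \<in> \<Q>" "Y' \<in> \<Q>" "Y \<noteq> Y'"
    then show "card (Y \<inter> Y') \<le> k - 1" using Qint by (metis (no_types, lifting) \<Q>_def imageE)
  qed (use cardQ in \<open>auto simp: \<Q>_def H_def\<close>)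
  have kg: "k_graph k H"
    using fQ by (fastforce simp: k_graph_def H_def \<Q>_def nsets_def)
  have eqk: "eqk_system e q k H"
    using coll kg k2 kq card_image[OF Qinj]
    by (auto simp: eqk_system_def qk_system_def l_qk_system_def \<Q>_def intro!: exI[of _ "Q ` {..<e}"])
  obtain c :: "nat \<Rightarrow> nat" where c: "c ` verts H \<subseteq> {..<chromatic_number H}"
    "\<And>E. E \<in> edges H \<Longrightarrow> \<not> monochromatic c E"
    using colorable_chromatic_number[OF kg k2] unfolding colorable_def by blast
  \<comment> \<open>By \<open>indep\<close>, a larger colour class would have \<open>k\<close>
    points in one block, and these form a monochromatic edge.\<close>
  have class_le: "card {v \<in> V. c (h v) = a} \<le> s" for a
  proof (rule ccontr)
    let ?S = "{v \<in> V. c (h v) = a}"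
    assume "\<not> card ?S \<le> s"
    then obtain i where i: "i \<in> I" "k \<le> card (?S \<inter> B i)" using indep[of ?S] by auto
    then obtain j where j: "j < card I" "i = g j" using g by (fastforce simp: bij_betw_def)
    obtain T where T: "T \<subseteq> ?S \<inter> B i" "card T = k" "finite T"
      using obtain_subset_with_card_n[OF i(2)] by blast
    have "h ` T \<subseteq> Q j" using T(1) j by (auto simp: Q_def C_def)
    moreover have "card (h ` T) = k"
      using T(1,2) by (subst card_image[OF inj_on_subset[OF hinj]]) auto
    ultimately have "h ` T \<in> nsets (Q j) k" using T(3) by (simp add: nsets_def)
    moreover have "Q j \<in> \<Q>" using j(1) cI by (simp add: \<Q>_def)
    ultimately have "h ` T \<in> edges H" by (auto simp: H_def)
    moreover have "monochromatic c (h ` T)"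
      using T(1) by (auto simp: monochromatic_def intro!: exI[of _ a])
    ultimately show False using c(2) by blast
  qed
  have "c (h v) < chromatic_number H" if "v \<in> V" for v
  proof -
    have "h v \<in> verts H" using him that by (auto simp: H_def)
    then show ?thesis using c(1) by blast
  qed
  then have "V \<subseteq> (\<Union>a<chromatic_number H. {v \<in> V. c (h v) = a})" by blast
  then have "card V \<le> card (\<Union>a<chromatic_number H. {v \<in> V. c (h v) = a})"
    using fV by (intro card_mono) auto
  also have "\<dots> \<le> (\<Sum>a<chromatic_number H. card {v \<in> V. c (h v) = a})"
    by (rule card_UN_le) simp
  also have "\<dots> \<le> (\<Sum>a<chromatic_number H. s)" by (intro sum_mono class_le)
  finally show ?thesis using that[OF eqk] by (simp add: mult.commute)
qed

section \<open>Polynomials of bounded degree with coefficients in a finite set\<close>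

definition polys_over :: "'a :: field set \<Rightarrow> nat \<Rightarrow> 'a poly set" where
  "polys_over F k = {p. degree p < k \<and> (\<forall>i. coeff p i \<in> F)}"

text \<open>Reading off the first \<open>k\<close> coefficients is injective into
  \<open>{..<k} \<rightarrow>\<^sub>E F\<close>, and onto when \<open>0 \<in> F\<close>, as the
  coefficients from \<open>k\<close> on vanish.\<close>

lemma finite_polys_over: "finite F \<Longrightarrow> finite (polys_over F k)"
  and card_polys_over: "finite F \<Longrightarrow> 0 \<in> F \<Longrightarrow> k \<ge> 1 \<Longrightarrow> card (polys_over F k) = card F ^ k"
proof -
  let ?c = "\<lambda>p. restrict (coeff p) {..<k}"
  have inj: "inj_on ?c (polys_over F k)"
  proof (intro inj_onI poly_eqI)
    fix p p' i assume p: "p \<in> polys_over F k" "p' \<in> polys_over F k" "?c p = ?c p'"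
    show "coeff p i = coeff p' i"
    proof (cases "i < k")
      case True
      then show ?thesis using fun_cong[OF p(3), of i] by simp
    next
      case False
      then show ?thesis using p(1,2) by (simp add: polys_over_def coeff_eq_0)
    qed
  qed
  have sub: "?c ` polys_over F k \<subseteq> {..<k} \<rightarrow>\<^sub>E F"
    by (rule image_subsetI) (simp add: polys_over_def restrict_PiE_iff)
  show "finite (polys_over F k)" if "finite F"
    using inj_on_finite[OF inj sub] that by (simp add: finite_PiE)
  show "card (polys_over F k) = card F ^ k" if "finite F" "0 \<in> F" "k \<ge> 1"
  proof -
    have "{..<k} \<rightarrow>\<^sub>E F \<subseteq> ?c ` polys_over F k"
    proof
      fix f assume f: "f \<in> {..<k} \<rightarrow>\<^sub>E F"
      define p where "p = (\<Sum>i<k. monom (f i) i)"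
      have co: "coeff p i = (if i < k then f i else 0)" for i
        by (simp add: p_def coeff_sum)
      have "degree p \<le> k - 1" by (rule degree_le) (auto simp: co)
      then have "degree p < k" using that(3) by linarith
      moreover have "coeff p i \<in> F" for i
        using PiE_mem[OF f, of i] that(2) by (simp add: co)
      ultimately have "p \<in> polys_over F k" by (simp add: polys_over_def)
      moreover have "f i = ?c p i" for i
        using PiE_arb[OF f, of i] by (simp add: co)
      then have "f = ?c p" by (rule ext)
      ultimately show "f \<in> ?c ` polys_over F k" by blast
    qed
    with sub have "?c ` polys_over F k = {..<k} \<rightarrow>\<^sub>E F" by blast
    then show ?thesis using card_image[OF inj] by (simp add: card_PiE)
  qed
qed

text \<open>Instead of Lagrange interpolation: evaluation at \<open>k\<close> points is injective on the
  polynomials over \<open>F\<close> of degree below \<open>k\<close>, hence bijective by counting.\<close>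

lemma ex_interpolating_poly:
  assumes F: "finite F" "0 \<in> F" "1 \<in> F" "\<And>x y. x \<in> F \<Longrightarrow> y \<in> F \<Longrightarrow> x + y \<in> F"
      "\<And>x y. x \<in> F \<Longrightarrow> y \<in> F \<Longrightarrow> x * y \<in> F"
    and Y: "Y \<subseteq> F" "card Y = k" "k \<ge> 1" and f: "\<And>x. x \<in> Y \<Longrightarrow> f x \<in> F"
  obtains p where "p \<in> polys_over F k" "\<And>x. x \<in> Y \<Longrightarrow> poly p x = f x"
proof -
  let ?ev = "\<lambda>p. restrict (poly p) Y"
  have fX: "finite Y" using Y F(1) finite_subset by blast
  have pow: "x ^ i \<in> F" if "x \<in> F" for x i using that F(3,5) by (induction i) auto
  have sumF: "(\<Sum>i\<in>I. u i) \<in> F" if "\<And>i. i \<in> I \<Longrightarrow> u i \<in> F" for I :: "nat set" and u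
    using that by (induction I rule: infinite_finite_induct) (auto simp: F)
  have ev: "poly p x \<in> F" if "p \<in> polys_over F k" "x \<in> F" for p x
    using that by (auto simp: poly_altdef polys_over_def intro!: sumF F(5) pow)
  have inj: "inj_on ?ev (polys_over F k)"
  proof (rule inj_onI, rule ccontr)
    fix p p' assume p: "p \<in> polys_over F k" "p' \<in> polys_over F k" "?ev p = ?ev p'" "p \<noteq> p'"
    have "Y \<subseteq> {x. poly (p - p') x = 0}"
    proof
      fix x assume "x \<in> Y"
      then show "x \<in> {x. poly (p - p') x = 0}" using fun_cong[OF p(3), of x] by simp
    qed
    then have "card Y \<le> card {x. poly (p - p') x = 0}"
      using p(4) by (intro card_mono poly_roots_finite) auto
    also have "\<dots> \<le> degree (p - p')" using p(4) by (intro card_poly_roots_bound) simp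
    also have "\<dots> < k" using p(1,2) by (auto simp: polys_over_def intro: degree_diff_less)
    finally show False using Y by simp
  qed
  have "?ev ` polys_over F k = Y \<rightarrow>\<^sub>E F"
  proof (rule card_subset_eq)
    show "finite (Y \<rightarrow>\<^sub>E F)" using fX F(1) by (intro finite_PiE) auto
    show "?ev ` polys_over F k \<subseteq> Y \<rightarrow>\<^sub>E F" using ev Y(1) by auto
    show "card (?ev ` polys_over F k) = card (Y \<rightarrow>\<^sub>E F)"
      using F(1,2) Y fX by (simp add: card_image[OF inj] card_polys_over card_PiE)
  qed
  moreover have "restrict f Y \<in> Y \<rightarrow>\<^sub>E F" using f by auto
  ultimately obtain p where p: "p \<in> polys_over F k" "restrict f Y = ?ev p" by force
  show ?thesis
  proof (rule that[OF p(1)])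
    show "poly p x = f x" if "x \<in> Y" for x using fun_cong[OF p(2), of x] that by simp
  qed
qed

text \<open>Here \<open>m\<close> is the number of curves: \<open>k * m \<le> q\<close> keeps the
  trace of a graph within the block size, \<open>card F ^ k + card F\<close> counts graphs and
  vertical lines, and \<open>(k - 1)\<^sup>2\<close> bounds the independent sets.\<close>

lemma ex_system_over_subfield:
  fixes F :: "'a :: field set"
  assumes F: "finite F" "0 \<in> F" "1 \<in> F" "\<And>x y. x \<in> F \<Longrightarrow> y \<in> F \<Longrightarrow> x + y \<in> F"
      "\<And>x y. x \<in> F \<Longrightarrow> y \<in> F \<Longrightarrow> x * y \<in> F"
    and k2: "k \<ge> 2" and kq: "k \<le> q" and m: "k * m \<le> q" "m \<le> card F"
    and e: "card F ^ k + card F \<le> e"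
  obtains H :: "nat hypergraph" where "eqk_system e q k H"
    "card F * m \<le> (k - 1)\<^sup>2 * chromatic_number H"
proof -
  obtain A where A: "A \<subseteq> F" "card A = m" "finite A"
    using obtain_subset_with_card_n[OF m(2)] by blast
  define V where "V = (\<lambda>(x, a). (x, x ^ k + a)) ` (F \<times> A)"
  have fV: "finite V" using F(1) A(3) by (simp add: V_def)
  have "inj_on (\<lambda>(x, a). (x, x ^ k + a)) (F \<times> A)" by (auto simp: inj_on_def)
  then have cV: "card V = card F * m" by (simp add: V_def card_image card_cartesian_product A(2))
  have pow: "x ^ i \<in> F" if "x \<in> F" for x i using that F(3,5) by (induction i) auto
  have VF: "V \<subseteq> F \<times> F" using A(1) pow F(4) by (auto simp: V_def)
  \<comment> \<open>\<open>Inl\<close> indexes the graphs of polynomials, \<open>Inr\<close> the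
    vertical lines.\<close>
  define I where "I = polys_over F k <+> F"
  define B where "B i = (case i of Inl p \<Rightarrow> {v \<in> V. snd v = poly p (fst v)}
    | Inr x \<Rightarrow> {v \<in> V. fst v = x})" for i
  have deg: "degree p < k" if "p \<in> polys_over F k" for p
    using that by (simp add: polys_over_def)
  have size_graph: "card (B (Inl p)) \<le> q" if p: "p \<in> polys_over F k" for p
  proof -
    \<comment> \<open>The roots of \<open>P a\<close> are the abscissas where the graph of
      \<open>p\<close> meets the curve with offset \<open>a\<close>. As \<open>degree p < k\<close>,
      the leading term survives and there are at most \<open>k\<close> of them.\<close>
    define P where "P a = monom 1 k + ([:a:] - p)" for a
    have degP: "degree (P a) = k" for a
    proof -
      have "degree ([:a:] - p) < degree (monom (1::'a) k)"
        using deg[OF p] k2 by (simp add: degree_monom_eq degree_diff_less)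
      then show ?thesis by (simp add: P_def degree_add_eq_left degree_monom_eq)
    qed
    have nz: "P a \<noteq> 0" for a using degP[of a] k2 by auto
    let ?R = "\<lambda>a. (\<lambda>x. (x, poly p x)) ` {x. poly (P a) x = 0}"
    have R: "finite {x. poly (P a) x = 0}" "card {x. poly (P a) x = 0} \<le> k" for a
      using poly_roots_finite[OF nz] card_poly_roots_bound[OF nz[of a]] degP by simp_all
    have "B (Inl p) \<subseteq> (\<Union>a\<in>A. ?R a)"
    proof
      fix v assume "v \<in> B (Inl p)"
      then obtain x a where v: "v = (x, x ^ k + a)" "a \<in> A" "x ^ k + a = poly p x"
        by (auto simp: B_def V_def)
      then have "poly (P a) x = 0" by (simp add: P_def poly_monom add_diff_eq)
      then show "v \<in> (\<Union>a\<in>A. ?R a)" using v by auto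
    qed
    then have "card (B (Inl p)) \<le> card (\<Union>a\<in>A. ?R a)"
      using A(3) R by (intro card_mono) auto
    also have "\<dots> \<le> (\<Sum>a\<in>A. card (?R a))" by (rule card_UN_le[OF A(3)])
    also have "\<dots> \<le> (\<Sum>a\<in>A. k)"
      using R by (intro sum_mono) (meson card_image_le le_trans)
    finally show ?thesis using m(1) A(2) by (simp add: mult.commute)
  qed
  have size_column: "card (B (Inr x)) \<le> q" for x
  proof -
    have "B (Inr x) \<subseteq> (\<lambda>a. (x, x ^ k + a)) ` A" by (auto simp: B_def V_def)
    then have "card (B (Inr x)) \<le> card A" by (rule surj_card_le[OF A(3)])
    also have "\<dots> \<le> k * m" using k2 A(2) by simp
    finally show ?thesis using m(1) by simp
  qed
  have fin: "finite (B i)" for i using fV by (auto simp: B_def split: sum.split)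
  have graphs: "card (B (Inl p) \<inter> B (Inl p')) \<le> k - 1"
    if p: "p \<in> polys_over F k" "p' \<in> polys_over F k" "p \<noteq> p'" for p p'
  proof -
    have nz: "p - p' \<noteq> 0" using p(3) by simp
    have "B (Inl p) \<inter> B (Inl p') \<subseteq> (\<lambda>x. (x, poly p x)) ` {x. poly (p - p') x = 0}"
      by (auto simp: B_def image_iff)
    then have "card (B (Inl p) \<inter> B (Inl p')) \<le> card {x. poly (p - p') x = 0}"
      by (rule surj_card_le[OF poly_roots_finite[OF nz]])
    also have "\<dots> \<le> degree (p - p')" by (rule card_poly_roots_bound[OF nz])
    also have "\<dots> < k" using deg p by (auto intro: degree_diff_less)
    finally show ?thesis by simp
  qed
  have graph_column: "card (B (Inl p) \<inter> B (Inr x)) \<le> k - 1" for p x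
  proof -
    have "B (Inl p) \<inter> B (Inr x) \<subseteq> {(x, poly p x)}" by (auto simp: B_def)
    then have "card (B (Inl p) \<inter> B (Inr x)) \<le> card {(x, poly p x)}" by (intro card_mono) auto
    then show ?thesis using k2 by simp
  qed
  have columns: "card (B (Inr x) \<inter> B (Inr x')) \<le> k - 1" if "x \<noteq> x'" for x x'
  proof -
    have "B (Inr x) \<inter> B (Inr x') = {}" using that by (auto simp: B_def)
    then show ?thesis by simp
  qed
  have indep: "\<exists>i\<in>I. k \<le> card (S \<inter> B i)" if S: "S \<subseteq> V" "(k - 1)\<^sup>2 < card S" for S
  proof (cases "\<exists>x\<in>F. k \<le> card (S \<inter> B (Inr x))")
    case True
    then show ?thesis by (auto simp: I_def)
  next
    case False
    have fS: "finite S" using S(1) fV finite_subset by blast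
    have sF: "fst ` S \<subseteq> F" using S(1) VF by auto
    have "S \<subseteq> (\<Union>x\<in>fst ` S. S \<inter> B (Inr x))" using S(1) by (auto simp: B_def)
    then have "card S \<le> card (\<Union>x\<in>fst ` S. S \<inter> B (Inr x))"
      using fS by (intro card_mono) auto
    also have "\<dots> \<le> (\<Sum>x\<in>fst ` S. card (S \<inter> B (Inr x)))" using fS by (intro card_UN_le) simp
    also have "\<dots> \<le> (\<Sum>x\<in>fst ` S. k - 1)" using False sF by (intro sum_mono) fastforce
    finally have "card S \<le> card (fst ` S) * (k - 1)" by simp
    \<comment> \<open>Pigeonhole: with at most \<open>k - 1\<close> points on each vertical line,
      \<open>S\<close> must meet at least \<open>k\<close> lines.\<close>
    then have "(k - 1) * (k - 1) < card (fst ` S) * (k - 1)"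
      using S(2) unfolding power2_eq_square by (rule less_le_trans[rotated])
    then have "k - 1 < card (fst ` S)" using mult_less_cancel2 by blast
    then have "k \<le> card (fst ` S)" by simp
    then obtain Y where Y: "Y \<subseteq> fst ` S" "card Y = k" "finite Y"
      by (rule obtain_subset_with_card_n)
    then have "\<forall>x\<in>Y. \<exists>y. (x, y) \<in> S" by force
    then obtain f where f: "\<And>x. x \<in> Y \<Longrightarrow> (x, f x) \<in> S" by metis
    \<comment> \<open>One point of \<open>S\<close> on each of \<open>k\<close> vertical lines: the
      interpolating graph is a block with \<open>k\<close> points of \<open>S\<close>.\<close>
    obtain p where p: "p \<in> polys_over F k" "\<And>x. x \<in> Y \<Longrightarrow> poly p x = f x"
    proof (rule ex_interpolating_poly[OF F, of Y k f])
      show "Y \<subseteq> F" using Y sF by blast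
      show "f x \<in> F" if "x \<in> Y" for x using f[OF that] S(1) VF by blast
    qed (use Y k2 in auto)
    have "(\<lambda>x. (x, f x)) ` Y \<subseteq> S \<inter> B (Inl p)" using f p(2) S(1) by (auto simp: B_def)
    then have "card ((\<lambda>x. (x, f x)) ` Y) \<le> card (S \<inter> B (Inl p))"
      using fS by (intro card_mono) auto
    moreover have "card ((\<lambda>x. (x, f x)) ` Y) = k"
      using Y(2) by (subst card_image) (auto simp: inj_on_def)
    ultimately show ?thesis using p(1) by (auto simp: I_def)
  qed
  show ?thesis
  proof (rule ex_padded_system[OF fV _ _ k2 kq, of I e B "(k - 1)\<^sup>2"])
    show "finite I" using F(1) by (simp add: I_def finite_polys_over)
    show "card I \<le> e"
      using F(1,2) k2 e by (simp add: I_def card_Plus finite_polys_over card_polys_over)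
    show "B i \<subseteq> V" for i by (auto simp: B_def split: sum.splits)
    show "card (B i) \<le> q" if "i \<in> I" for i
      using that size_graph size_column by (auto simp: I_def)
    show "card (B i \<inter> B j) \<le> k - 1" if "i \<in> I" "j \<in> I" "i \<noteq> j" for i j
    proof (cases i)
      case (Inl p)
      then show ?thesis using that graphs graph_column by (cases j) (auto simp: I_def)
    next
      case (Inr x)
      then show ?thesis
        using that columns graph_column by (cases j) (auto simp: I_def Int_commute[of "B (Inr x)"])
    qed
    show "\<exists>i\<in>I. k \<le> card (S \<inter> B i)" if "S \<subseteq> V" "(k - 1)\<^sup>2 < card S" for S
      using indep that .
  qed (use that cV in auto)
qed

text \<open>The field order \<open>2 ^ m\<close> is taken as large as \<open>e\<close> permits, so
  that \<open>e^(1/k) < 4 * 2 ^ m\<close>. The constant \<open>8 * k^3\<close> collects this 4, a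
  factor \<open>2 * k\<close> from rounding in \<open>q div k\<close>, and \<open>k\<^sup>2\<close>
  as a bound for \<open>(k - 1)\<^sup>2\<close>.\<close>

lemma ex_eqk_system_large_chromatic_number:
  assumes k2: "k \<ge> 2" and q: "q > k" and e: "(50 * q) ^ k < e"
  obtains H :: "nat hypergraph" where "eqk_system e q k H"
    "1 / (8 * real k ^ 3) * real e powr (1 / real k) * real q \<le> real (chromatic_number H)"
proof -
  \<comment> \<open>The factor 2 leaves room for the \<open>2 ^ m\<close> vertical lines besides the
    \<open>(2 ^ m) ^ k\<close> graphs.\<close>
  define P where "P m \<longleftrightarrow> 2 * (2 ^ m) ^ k \<le> e" for m :: nat
  \<comment> \<open>A crude bound, serving only the existence of a greatest
    \<open>m\<close>.\<close>
  have bound: "m \<le> e" if "P m" for m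
  proof -
    have "m \<le> 2 ^ m" by (simp add: less_imp_le)
    also have "\<dots> \<le> (2 ^ m) ^ k" using k2 by (intro self_le_power) auto
    finally show ?thesis using that by (simp add: P_def)
  qed
  have "1 < (50 * q) ^ k" using q k2 by (intro one_less_power) auto
  then have "P 0" using e by (simp add: P_def)
  define m where "m = Greatest P"
  have Pm: "P m" unfolding m_def by (rule GreatestI_nat[of P 0 e, OF \<open>P 0\<close>]) (rule bound)
  have "\<not> P (Suc m)"
    using Greatest_le_nat[of P "Suc m" e] bound by (auto simp flip: m_def)
  then have "e < 2 * (2 ^ Suc m) ^ k" by (simp add: P_def)
  \<comment> \<open>Enlarging 2 to \<open>2 ^ k\<close> moves it into the base, which becomes
    \<open>4 * 2 ^ m\<close>.\<close>
  also have "\<dots> \<le> 2 ^ k * (2 ^ Suc m) ^ k"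
    using k2 by (intro mult_right_mono self_le_power) auto
  also have "\<dots> = (4 * 2 ^ m) ^ k" by (subst power_mult_distrib[symmetric]) simp
  finally have e_less: "e < (4 * 2 ^ m) ^ k" .
  then have "(50 * q) ^ k < (4 * 2 ^ m) ^ k" using e by linarith
  then have "50 * q < 4 * 2 ^ m" by (rule power_less_imp_less_base) simp
  then have qm: "q < 2 ^ m" by linarith
  then have "m \<ge> 1" using q k2 by (cases m) auto
  then obtain F :: "bit alg_closure set" where F: "finite F" "card F = 2 ^ m" "0 \<in> F" "1 \<in> F"
    "\<And>x y. x \<in> F \<Longrightarrow> y \<in> F \<Longrightarrow> x + y \<in> F" "\<And>x y. x \<in> F \<Longrightarrow> y \<in> F \<Longrightarrow> x * y \<in> F"
    using ex_finite_subfield_power_2 by blast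
  have "(2 ^ m :: nat) \<le> (2 ^ m) ^ k" using k2 by (intro self_le_power) auto
  then have "card F ^ k + card F \<le> e" using Pm by (simp add: F(2) P_def)
  moreover have "q div k \<le> card F" using qm by (simp add: F(2)) (meson div_le_dividend le_trans less_imp_le)
  ultimately obtain H :: "nat hypergraph" where H: "eqk_system e q k H"
    "card F * (q div k) \<le> (k - 1)\<^sup>2 * chromatic_number H"
    using ex_system_over_subfield[OF F(1,3-6) k2, of q "q div k" e] q by auto
  let ?t = "real e powr (1 / real k)"
  have "?t ^ k = real e" using k2 e by (simp add: powr_power)
  also have "\<dots> < real ((4 * 2 ^ m) ^ k)" using e_less by (simp only: of_nat_less_iff)
  finally have "?t ^ k < (4 * 2 ^ m) ^ k" by simp
  then have t: "?t < 4 * 2 ^ m" by (rule power_less_imp_less_base) simp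
  \<comment> \<open>The remainder is below \<open>k \<le> k * (q div k)\<close>, so rounding down at
    most halves \<open>q\<close>.\<close>
  have "q = k * (q div k) + q mod k" by simp
  moreover have "q mod k < k" using k2 by simp
  moreover have "1 \<le> q div k" using q k2 by (simp add: div_greater_zero_iff Suc_le_eq)
  then have "k * 1 \<le> k * (q div k)" by (intro mult_le_mono2)
  ultimately have "q \<le> 2 * (k * (q div k))" by linarith
  then have q_le: "real q \<le> 2 * real k * real (q div k)"
    by (metis (no_types, lifting) mult.assoc of_nat_le_iff of_nat_mult of_nat_numeral)
  have "?t * real q \<le> (4 * 2 ^ m) * (2 * real k * real (q div k))"
    using t q_le by (intro mult_mono) auto
  also have "\<dots> = 8 * real k * real (card F * (q div k))" by (simp add: F(2))
  also have "\<dots> \<le> 8 * real k * real (k\<^sup>2 * chromatic_number H)"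
  proof (intro mult_left_mono of_nat_mono)
    have "(k - 1)\<^sup>2 \<le> k\<^sup>2" by (intro power_mono) auto
    then show "card F * (q div k) \<le> k\<^sup>2 * chromatic_number H"
      using H(2) mult_le_mono1 le_trans by blast
  qed auto
  also have "\<dots> = 8 * real k ^ 3 * real (chromatic_number H)"
    by (simp add: power2_eq_square power3_eq_cube)
  finally have "1 / (8 * real k ^ 3) * ?t * real q \<le> real (chromatic_number H)"
    using k2 by (simp add: field_simps)
  then show ?thesis using that H(1) by blast
qed

theorem theorem1:
  fixes k :: nat
  assumes "k \<ge> 2"
  shows "\<exists>(c::real) (q0::nat). c > 0 \<and>
    (\<forall>q e :: nat. q > k \<and> q \<ge> q0 \<and> (50 * q) ^ k < e \<and> e < 2 ^ q \<longrightarrow>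
       (\<exists>H :: nat hypergraph. eqk_system e q k H \<and>
          real (chromatic_number H) \<ge> c * real e powr (1 / real k) * real q)) \<and>
    (\<exists>(c1::real) (c2::real). 0 < c1 \<and> c1 \<le> c2 \<and>
       (\<forall>q e :: nat. q > k \<and> q \<ge> q0 \<and> (50 * q) ^ k < e \<and> e < 2 ^ q \<longrightarrow>
          c1 * real e powr (1 / real k) * real q \<le> real (f_max e q k) \<and>
          real (f_max e q k) \<le> c2 * real e powr (1 / real k) * real q))"
proof -
  let ?c = "1 / (8 * real k ^ 3)"
  have c: "0 < ?c" using assms by simp
  have "1 \<le> real k ^ 3" using assms by (intro one_le_power) simp
  then have "?c \<le> 1 / 1" by (intro frac_le) auto
  then have c4: "?c \<le> 4" by simp
  have lower: "\<exists>H :: nat hypergraph. eqk_system e q k H \<and>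
      ?c * real e powr (1 / real k) * real q \<le> real (chromatic_number H)"
    if "q > k" "(50 * q) ^ k < e" for q e
    using ex_eqk_system_large_chromatic_number[OF assms that] by blast
  have fmax: "?c * real e powr (1 / real k) * real q \<le> real (f_max e q k) \<and>
      real (f_max e q k) \<le> 4 * real e powr (1 / real k) * real q"
    if qe: "q > k" "(50 * q) ^ k < e" for q e
  proof -
    define Y where "Y = {chromatic_number H | H :: nat hypergraph. eqk_system e q k H}"
    have up: "real x \<le> 4 * real e powr (1 / real k) * real q" if "x \<in> Y" for x
      using that qe assms by (auto simp: Y_def intro!: chromatic_number_eqk_system_le)
    \<comment> \<open>The upper bound makes \<open>Y\<close> finite, so that \<open>Max\<close> is a
      true maximum.\<close>
    have "Y \<subseteq> {..nat \<lfloor>4 * real e powr (1 / real k) * real q\<rfloor>}"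
      using up by (auto simp: le_nat_floor)
    then have fX: "finite Y" by (rule finite_subset) simp
    obtain H :: "nat hypergraph" where H: "eqk_system e q k H"
      "?c * real e powr (1 / real k) * real q \<le> real (chromatic_number H)"
      using lower[OF qe] by blast
    have HX: "chromatic_number H \<in> Y" using H(1) unfolding Y_def by blast
    have "chromatic_number H \<le> Max Y" by (rule Max_ge[OF fX HX])
    moreover have "Max Y \<in> Y" using fX HX by (intro Max_in) auto
    moreover have "f_max e q k = Max Y" by (simp add: f_max_def Y_def)
    ultimately show ?thesis using H(2) up[of "Max Y"] by simp
  qed
  show ?thesis
  \<comment> \<open>The two bounds are available for every \<open>q > k\<close>, hence the threshold
    \<open>0\<close>.\<close>
  proof (rule exI[of _ ?c], rule exI[of _ "0::nat"], rule conjI[OF c], rule conjI)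
    show "\<exists>c1 c2. 0 < c1 \<and> c1 \<le> c2 \<and>
       (\<forall>q e :: nat. q > k \<and> q \<ge> 0 \<and> (50 * q) ^ k < e \<and> e < 2 ^ q \<longrightarrow>
          c1 * real e powr (1 / real k) * real q \<le> real (f_max e q k) \<and>
          real (f_max e q k) \<le> c2 * real e powr (1 / real k) * real q)"
      by (rule exI[of _ ?c], rule exI[of _ "4::real"], intro conjI c c4) (use fmax in blast)
  qed (use lower in blast)
qed

end
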